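(* Let $p$ be a Mersenne prime and let $Q = (p^4-1)/(p-1) = (p+1)(p^2+1)$. Then the number of non-zero elements $\xi \in \mathbb{F}_{p^4}^*$ with multiplicative order $2Q$ and with $\operatorname{Tr}_{\mathbb{F}_{p^4}/\mathbb{F}_p}(\xi) = 0$ is $$\frac{\phi(2Q)}{p+1} = 2\phi(p^2+1).$$
   Context: $\phi$ is Euler's function. A Mersenne prime is a prime of the form $2^\ell - 1$ with $\ell$ prime. *)

theory Defs
  imports "HOL-Number_Theory.Totient" "HOL-Algebra.Multiplicative_Group"
begin

definition mersenne_prime :: "nat \<Rightarrow> bool" where
  "mersenne_prime p \<longleftrightarrow> prime p \<and> (\<exists>l. prime l \<and> p = 2 ^ l - 1)"

text \<open>
  The trace from a field \<open>F\<close> of order \<open>q ^ n\<close> to its subfield of order \<open>q\<close>, as the sum of the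
  conjugates \<open>x, x ^ q, \<dots>, x ^ (q ^ (n - 1))\<close> of \<open>x\<close>. The value is an element of \<open>F\<close>, fixed by
  the \<open>q\<close>-th power map. The definition is meaningful only if \<open>F\<close> is a field of order \<open>q ^ n\<close>.
\<close>

definition ff_trace :: "('a, 'b) ring_scheme \<Rightarrow> nat \<Rightarrow> nat \<Rightarrow> 'a \<Rightarrow> 'a" where
  "ff_trace F q n x = (\<Oplus>\<^bsub>F\<^esub> i\<in>{..<n}. x [^]\<^bsub>F\<^esub> (q ^ i))"

end

theory Submission
  imports Defs
begin

text \<open>
  Let \<open>u = \<xi> ^ (p\<^sup>2 - 1)\<close> and \<open>t = \<xi> + \<xi> ^ (p\<^sup>2) = \<xi> * (1 + u)\<close>. The trace of \<open>\<xi>\<close> is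
  \<open>t + t ^ p\<close>, so for \<open>t \<noteq> 0\<close> it vanishes exactly when \<open>t ^ (p - 1) = -1\<close>
  (\<open>trace_zero_iff\<close>). The proof shows that \<open>\<xi> \<mapsto> u\<close> maps the elements to be counted two-to-one
  onto the elements of order \<open>p\<^sup>2 + 1\<close>, of which there are \<open>\<phi>(p\<^sup>2 + 1)\<close>.

  If \<open>\<xi>\<close> has order \<open>2 * Q\<close>, then \<open>u\<close> has order \<open>p\<^sup>2 + 1\<close>, because \<open>p \<equiv> 3\<close> modulo \<open>4\<close>
  gives \<open>gcd (2 * Q) (p\<^sup>2 - 1) = 2 * (p + 1)\<close>; in particular \<open>1 + u \<noteq> 0\<close>.

  Conversely let \<open>u\<close> have order \<open>p\<^sup>2 + 1\<close>. The Frobenius map gives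
  \<open>(1 + u) ^ (p\<^sup>2) = 1 + 1 / u = (1 + u) / u\<close> (\<open>one_plus_power\<close>), so every \<open>\<xi> = c / (1 + u)\<close> with
  \<open>c ^ (p - 1) = -1\<close> has trace zero and is mapped to \<open>u\<close>. These \<open>\<xi>\<close> form a coset of the group of
  \<open>(p - 1)\<close>-th roots of unity. The group of all units has order \<open>2 * Q * ((p - 1) / 2)\<close> with coprime
  factors \<open>2 * Q\<close> and \<open>(p - 1) / 2\<close>, so the coset contains elements with \<open>\<xi> ^ (2 * Q) = 1\<close>
  (\<open>fibre_nonempty\<close>), and precisely two of them, which differ by sign (\<open>fibre_two_elements\<close>).
  Their order is exactly \<open>2 * Q\<close>: here the Mersenne condition enters, as \<open>2 * (p + 1)\<close> is a power
  of \<open>2\<close> and the order of \<open>u\<close> already forces the full power of \<open>2\<close> in the order of \<open>\<xi>\<close>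
  (\<open>order_eq_from_quotient\<close>).

  The count is thus \<open>2 * \<phi>(p\<^sup>2 + 1)\<close>, and \<open>\<phi>(2 * Q) = 2 * (p + 1) * \<phi>(p\<^sup>2 + 1)\<close> because
  \<open>2 * (p + 1)\<close> is a power of \<open>2\<close> and \<open>p\<^sup>2 + 1\<close> is even.
\<close>

section \<open>The Frobenius endomorphism\<close>

lemma (in cring) binomial_theorem:
  fixes n :: nat
  assumes a: "a \<in> carrier R" and b: "b \<in> carrier R"
  shows "(a \<oplus> b) [^] n = (\<Oplus>k\<in>{..n}. [(n choose k)] \<cdot> (a [^] k \<otimes> b [^] (n - k)))"
proof (induction n)
  case 0
  show ?case by (simp add: a b)
next
  case (Suc n)
  let ?t = "\<lambda>m (c::nat) k. [c] \<cdot> (a [^] k \<otimes> b [^] (m - k))"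
  let ?S = "\<Oplus>k\<in>{..n}. ?t n (n choose k) k"
  have [simp]: "?t m c k \<in> carrier R" for m c k :: nat
    using a b by simp
  have "?S \<otimes> a = (\<Oplus>k\<in>{..n}. ?t (Suc n) (n choose k) (Suc k))"
    using a b
    by (subst finsum_ldistr)
       (auto intro!: add.finprod_cong' simp: add_pow_ldistr add_pow_rdistr m_ac)
  moreover have "?S \<otimes> b
      = (\<Oplus>k\<in>{..n}. ?t (Suc n) (n choose Suc k) (Suc k)) \<oplus> ?t (Suc n) 1 0"
  proof -
    have "?S \<otimes> b = (\<Oplus>k\<in>{..n}. ?t (Suc n) (n choose k) k)"
      using a b
      by (subst finsum_ldistr)
         (auto intro!: add.finprod_cong' simp: add_pow_ldistr m_assoc Suc_diff_le)
    also have "\<dots> = (\<Oplus>k\<in>{..Suc n}. ?t (Suc n) (n choose k) k)"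
      using a b by (subst finsum_Suc) (auto simp: binomial_eq_0)
    also have "\<dots> = (\<Oplus>k\<in>{..n}. ?t (Suc n) (n choose Suc k) (Suc k)) \<oplus> ?t (Suc n) 1 0"
      by (subst finsum_Suc2) (use a b in auto)
    finally show ?thesis .
  qed
  moreover have "(\<Oplus>k\<in>{..n}. ?t (Suc n) (n choose k) (Suc k))
      \<oplus> (\<Oplus>k\<in>{..n}. ?t (Suc n) (n choose Suc k) (Suc k))
      = (\<Oplus>k\<in>{..n}. ?t (Suc n) (Suc n choose Suc k) (Suc k))"
    using a b
    by (subst finsum_addf[symmetric])
       (auto intro!: add.finprod_cong' simp: add.nat_pow_mult)
  moreover have "(\<Oplus>k\<in>{..Suc n}. ?t (Suc n) (Suc n choose k) k)
      = (\<Oplus>k\<in>{..n}. ?t (Suc n) (Suc n choose Suc k) (Suc k)) \<oplus> ?t (Suc n) 1 0"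
    by (subst finsum_Suc2) (use a b in auto)
  moreover have "?S \<in> carrier R" "\<And>c. (\<Oplus>k\<in>{..n}. ?t (Suc n) (c k) (Suc k)) \<in> carrier R"
    using a b by auto
  \<comment> \<open>Pascal's rule must stay folded so that the coefficients match those of the sums above.\<close>
  ultimately show ?case
    using a b Suc.IH by (simp add: r_distr a_assoc[symmetric] del: binomial_Suc_Suc)
qed

text \<open>
  All the inner binomial coefficients are divisible by \<open>p\<close>, so only the two outer terms of the
  binomial expansion survive.
\<close>
lemma (in cring) frobenius_add:
  fixes p :: nat
  assumes p: "prime p" and char: "[p] \<cdot> \<one> = \<zero>"
    and a: "a \<in> carrier R" and b: "b \<in> carrier R"
  shows "(a \<oplus> b) [^] p = a [^] p \<oplus> b [^] p"
proof -
  obtain m where m: "p = Suc (Suc m)"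
    using prime_ge_2_nat[OF p] that[of "p - 2"] by simp
  have zero: "[n] \<cdot> x = \<zero>" if "p dvd n" "x \<in> carrier R" for n :: nat and x
  proof -
    from \<open>p dvd n\<close> obtain k where k: "n = p * k" ..
    have "[p] \<cdot> x = ([p] \<cdot> \<one>) \<otimes> x"
      using that by (simp add: add_pow_ldistr)
    with char that have "[p] \<cdot> x = \<zero>" by simp
    then have "[k] \<cdot> ([p] \<cdot> x) = \<zero>" by simp
    with that show ?thesis by (simp add: k add.nat_pow_pow)
  qed
  let ?f = "\<lambda>k. [(p choose k)] \<cdot> (a [^] k \<otimes> b [^] (p - k))"
  have f: "?f k \<in> carrier R" for k using a b by simp
  have "(a \<oplus> b) [^] p = (\<Oplus>k\<in>{..Suc (Suc m)}. ?f k)"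
    by (simp only: binomial_theorem[OF a b] m[symmetric])
  also have "\<dots> = ?f (Suc (Suc m)) \<oplus> ((\<Oplus>k\<in>{..m}. ?f (Suc k)) \<oplus> ?f 0)"
    by (subst finsum_Suc, use f in force, subst finsum_Suc2) (use f in auto)
  also have "(\<Oplus>k\<in>{..m}. ?f (Suc k)) = (\<Oplus>k\<in>{..m}. \<zero>)"
  proof (rule add.finprod_cong')
    fix k assume "k \<in> {..m}"
    then have "p dvd (p choose Suc k)"
      using p by (intro dvd_choose_prime) (auto simp: m)
    then show "?f (Suc k) = \<zero>" using a b by (intro zero) auto
  qed auto
  finally show ?thesis using a b by (simp add: m[symmetric])
qed

text \<open>
  In the additive group the order annihilates \<open>\<one>\<close>, and \<open>[p ^ n] \<cdot> \<one>\<close> is the \<open>n\<close>-th power of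
  \<open>[p] \<cdot> \<one>\<close>; without zero divisors the base must vanish already.
\<close>
lemma (in domain) finite_domain_char:
  fixes p n :: nat
  assumes "order R = p ^ n" and "0 < n" and "0 < p"
  shows "[p] \<cdot> \<one> = \<zero>"
proof -
  have "[(p ^ n)] \<cdot> \<one> = \<zero>"
    using add.pow_order_eq_1[of \<one>] assms by (simp add: order_def)
  moreover have "[(p ^ k)] \<cdot> \<one> = ([p] \<cdot> \<one>) [^] k" for k :: nat
  proof (induction k)
    case (Suc k)
    have "[(p ^ Suc k)] \<cdot> \<one> = [(p ^ k)] \<cdot> ([p] \<cdot> \<one>)"
      by (simp add: add.nat_pow_pow mult.commute)
    also have "\<dots> = ([(p ^ k)] \<cdot> \<one>) \<otimes> ([p] \<cdot> \<one>)"
      by (simp add: add_pow_ldistr)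
    finally show ?case by (simp add: Suc)
  qed simp
  ultimately have "([p] \<cdot> \<one>) [^] n = \<zero>" by simp
  then show ?thesis
    by (induction n) (auto dest: integral)
qed

lemma (in cring) frobenius_iterate_add:
  fixes p i :: nat
  assumes p: "prime p" and char: "[p] \<cdot> \<one> = \<zero>"
    and a: "a \<in> carrier R" and b: "b \<in> carrier R"
  shows "(a \<oplus> b) [^] (p ^ i) = a [^] (p ^ i) \<oplus> b [^] (p ^ i)"
proof (induction i)
  case (Suc i)
  have "(a \<oplus> b) [^] (p ^ Suc i) = ((a \<oplus> b) [^] (p ^ i)) [^] p"
    using a b by (simp add: nat_pow_pow mult.commute)
  with Suc show ?case
    using a b frobenius_add[OF p char] by (simp add: nat_pow_pow mult.commute)
qed (simp add: a b)

section \<open>Element orders in a finite field\<close>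

lemma ord_generator:
  fixes R (structure)
  assumes "field R" and fin: "finite (carrier R)"
  shows "\<exists>g\<in>carrier (mult_of R). group.ord (mult_of R) g = order R - 1"
proof -
  interpret field R by fact
  interpret G: group "mult_of R" by (rule field_mult_group)
  have fin': "finite (carrier (mult_of R))" using fin by simp
  obtain g where g: "g \<in> carrier (mult_of R)"
    and gen: "carrier (mult_of R) = {g [^] i | i::nat. i \<in> UNIV}"
    using finite_field_mult_group_has_gen[OF fin] by blast
  have "carrier (mult_of R) = (\<lambda>i. g [^]\<^bsub>mult_of R\<^esub> i) ` {0..G.ord g - 1}"
    using G.ord_elems[OF fin' g] gen by (auto simp: nat_pow_mult_of)
  then have "order (mult_of R) = card {0..G.ord g - 1}"
    unfolding order_def using card_image[OF G.ord_inj[OF g]] by simp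
  also have "\<dots> = G.ord g" using G.ord_ge_1[OF fin' g] by simp
  finally show ?thesis using g order_mult_of[OF fin] by auto
qed

text \<open>
  The multiplicative group is cyclic, so a suitable power of a generator has order \<open>d\<close>; its powers
  exhaust the roots of \<open>x ^ d - 1\<close>, and \<open>totient d\<close> of them have full order.
\<close>
lemma card_elements_of_order:
  fixes R (structure)
  assumes "field R" and fin: "finite (carrier R)" and d: "d dvd order R - 1"
  shows "card {x \<in> carrier (mult_of R). group.ord (mult_of R) x = d} = totient d"
proof -
  interpret field R by fact
  interpret G: group "mult_of R" by (rule field_mult_group)
  obtain g where g: "g \<in> carrier (mult_of R)" "G.ord g = order R - 1"
    using ord_generator[OF assms(1) fin] by blast
  have pos: "order R - 1 > 0" using G.ord_ge_1[of g] g fin by simp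
  obtain k where k: "order R - 1 = d * k" using d ..
  have "G.ord (g [^]\<^bsub>mult_of R\<^esub> k) = d"
    using g k pos by (subst G.ord_pow) auto
  then have "card {x \<in> carrier (mult_of R). G.ord x = d} = phi' d"
    using d g by (intro num_elems_of_ord_eq_phi' fin) (auto simp: order_mult_of[OF fin] intro!: bexI[of _ "g [^]\<^bsub>mult_of R\<^esub> k"] simp del: carrier_mult_of)
  also have "phi' d = totient d"
    unfolding phi'_def totient_def totatives_def by (rule arg_cong[of _ _ card]) auto
  finally show ?thesis .
qed

section \<open>Arithmetic of the exponents\<close>

text \<open>
  Modulo \<open>p - 1\<close> the base \<open>p\<close> is \<open>1\<close>, so \<open>2 * (p\<^sup>2 + 1)\<close> and \<open>2 * (p + 1) * (p\<^sup>2 + 1)\<close> reduce to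
  \<open>4\<close> and \<open>8\<close>. The hypothesis makes \<open>p - 1\<close> twice an odd number, so these powers of \<open>2\<close> share
  exactly a factor \<open>2\<close> with it.
\<close>
lemma gcd_exponents:
  fixes p :: nat
  assumes "p mod 4 = 3"
  shows "gcd (2 * ((p + 1) * (p\<^sup>2 + 1))) (p - 1) = 2"
    and "gcd (2 * ((p + 1) * (p\<^sup>2 + 1))) (p\<^sup>2 - 1) = 2 * (p + 1)"
proof -
  obtain r where r: "p = 4 * r + 3"
    using assms by (metis mod_div_decomp mult.commute)
  define m where "m = 4 * r + 2"
  have m: "p - 1 = m" "p = m + 1" by (simp_all add: r m_def)
  have gcd_m: "gcd (2 * 2 ^ i) m = 2" for i
  proof -
    have "gcd (2 * 2 ^ i) m = 2 * gcd (2 ^ i) (2 * r + 1)"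
      unfolding m_def gcd_mult_distrib_nat by (simp add: algebra_simps)
    moreover have "coprime (2 ^ i) (2 * r + 1)" by simp
    ultimately show ?thesis by (simp only: coprime_iff_gcd_eq_1)
  qed
  have gcd_mod: "gcd (a + m * b) m = gcd a m" for a b
    by (metis add.commute gcd.commute gcd_add_mult mult.commute)
  have "2 * (p\<^sup>2 + 1) = 2 * 2 ^ 1 + m * (2 * m + 4)"
    by (simp add: m power2_eq_square algebra_simps)
  then have *: "gcd (2 * (p\<^sup>2 + 1)) m = 2"
    using gcd_m[of 1] gcd_mod by metis
  have "2 * ((p + 1) * (p\<^sup>2 + 1)) = 2 * 2 ^ 2 + m * (2 * m * m + 8 * m + 12)"
    by (simp add: m power2_eq_square algebra_simps)
  then show "gcd (2 * ((p + 1) * (p\<^sup>2 + 1))) (p - 1) = 2"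
    using gcd_m[of 2] gcd_mod m(1) by metis
  have "p\<^sup>2 - 1 = (p + 1) * m"
    by (simp add: m power2_eq_square algebra_simps)
  then have "gcd (2 * ((p + 1) * (p\<^sup>2 + 1))) (p\<^sup>2 - 1)
      = gcd ((p + 1) * (2 * (p\<^sup>2 + 1))) ((p + 1) * m)"
    by (simp only: mult.left_commute)
  then show "gcd (2 * ((p + 1) * (p\<^sup>2 + 1))) (p\<^sup>2 - 1) = 2 * (p + 1)"
    unfolding gcd_mult_distrib_nat[symmetric] * by simp
qed

text \<open>
  If \<open>x\<close> has order \<open>d\<close>, then \<open>x ^ (p\<^sup>2 - 1)\<close> has the order in the last hypothesis; the lemma
  recovers \<open>d\<close> from it. Here \<open>p + 1\<close> has to be a power of \<open>2\<close>: the cofactor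
  \<open>g = d div (p\<^sup>2 + 1)\<close> is a power \<open>2 ^ j\<close> dividing \<open>2 * (p + 1)\<close>. It is also the gcd of \<open>d\<close>
  and \<open>p\<^sup>2 - 1\<close>, and as \<open>p\<^sup>2 + 1\<close> is even, \<open>d\<close> contains a further factor \<open>2\<close>. The gcd stops at
  \<open>2 ^ j\<close> only because \<open>p\<^sup>2 - 1\<close> has no further factor \<open>2\<close>, which forces \<open>j\<close> to be maximal.
\<close>
lemma order_eq_from_quotient:
  fixes p l d :: nat
  assumes l: "p + 1 = 2 ^ l" and p: "p > 1"
    and dvd: "d dvd 2 * ((p + 1) * (p\<^sup>2 + 1))"
    and d: "d div gcd d (p\<^sup>2 - 1) = p\<^sup>2 + 1"
  shows "d = 2 * ((p + 1) * (p\<^sup>2 + 1))"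
proof -
  define g where "g = gcd d (p\<^sup>2 - 1)"
  have d_eq: "d = g * (p\<^sup>2 + 1)"
    using d unfolding g_def by (metis dvd_mult_div_cancel gcd_dvd1)
  with dvd have "g * (p\<^sup>2 + 1) dvd 2 ^ Suc l * (p\<^sup>2 + 1)"
    by (simp only: l mult.assoc power_Suc)
  then have "g dvd 2 ^ Suc l"
    by (subst (asm) dvd_times_right_cancel_iff) simp_all
  then obtain j where j: "j \<le> Suc l" "g = 2 ^ j"
    using divides_primepow_nat two_is_prime_nat by blast
  have "l > 0" using l p by (cases l) auto
  then have "odd p" using l by (metis even_add even_power odd_one even_numeral neq0_conv)
  \<comment> \<open>Otherwise \<open>2 ^ (j + 1)\<close> would divide both arguments of the gcd \<open>g = 2 ^ j\<close>.\<close>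
  have "j = Suc l"
  proof (rule ccontr)
    assume "j \<noteq> Suc l"
    with j have "Suc j \<le> Suc l" by simp
    have "even (p\<^sup>2 + 1)" using \<open>odd p\<close> by simp
    then have "2 ^ Suc j dvd d"
      unfolding d_eq j(2) power_Suc2 by (intro mult_dvd_mono) simp_all
    moreover have "2 ^ Suc j dvd p\<^sup>2 - 1"
    proof -
      have "2 ^ Suc j dvd 2 ^ l * (2::nat)"
        using le_imp_power_dvd[OF \<open>Suc j \<le> Suc l\<close>, of "2::nat"] by (simp add: mult.commute)
      also have "2 ^ l * 2 dvd (p + 1) * (p - 1)"
        unfolding l using \<open>odd p\<close> by (intro mult_dvd_mono) auto
      also have "(p + 1) * (p - 1) = p\<^sup>2 - 1"
        using p by (simp add: power2_eq_square algebra_simps)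
      finally show ?thesis .
    qed
    ultimately have "2 ^ Suc j dvd g" unfolding g_def by simp
    then have "2 ^ Suc j \<le> (2::nat) ^ j" unfolding j(2) by (rule dvd_imp_le) simp
    then show False by simp
  qed
  then show ?thesis using d_eq j(2) l by simp
qed

section \<open>Roots of \<open>\<one>\<close> and of \<open>\<ominus> \<one>\<close>\<close>

lemma (in domain) square_eq_one:
  assumes "x \<in> carrier R" "x [^] (2::nat) = \<one>"
  shows "x = \<one> \<or> x = \<ominus> \<one>"
proof -
  have "(x \<ominus> \<one>) \<otimes> (x \<oplus> \<one>) = x [^] (2::nat) \<ominus> \<one>"
    using assms(1) by (simp add: numeral_2_eq_2) algebra
  with assms have "(x \<ominus> \<one>) \<otimes> (x \<oplus> \<one>) = \<zero>" by simp
  then have "x \<ominus> \<one> = \<zero> \<or> x \<oplus> \<one> = \<zero>"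
    using assms(1) integral[of "x \<ominus> \<one>" "x \<oplus> \<one>"] by blast
  then show ?thesis
    using assms(1) by (metis minus_equality one_closed r_right_minus_eq)
qed

lemma (in cring) minus_power_even:
  assumes "x \<in> carrier R" "even (n::nat)"
  shows "(\<ominus> x) [^] n = x [^] n"
proof -
  obtain m where m: "n = 2 * m" using assms by blast
  have "(\<ominus> x) [^] (2::nat) = x [^] (2::nat)"
    using assms by (simp add: numeral_2_eq_2 l_minus r_minus)
  then show ?thesis using assms m by (simp add: nat_pow_pow[symmetric])
qed

text \<open>
  An element of order \<open>2 * n\<close> serves as \<open>c\<close>: its \<open>n\<close>-th power is a square root of \<open>\<one>\<close> other than
  \<open>\<one>\<close>, which also separates \<open>\<ominus> \<one>\<close> from \<open>\<one>\<close>.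
\<close>
lemma (in field) root_of_minus_one:
  assumes fin: "finite (carrier R)" and n: "n > 0" and dvd: "2 * n dvd order R - 1"
  obtains c where "c \<in> carrier R - {\<zero>}" "c [^] n = \<ominus> \<one>" "\<ominus> \<one> \<noteq> \<one>"
proof -
  interpret G: group "mult_of R"
    rewrites "([^]\<^bsub>mult_of R\<^esub>) = (([^]) :: _ \<Rightarrow> nat \<Rightarrow> _)"
      and "\<one>\<^bsub>mult_of R\<^esub> = \<one>"
      and "carrier (mult_of R) = carrier R - {\<zero>}"
      and "mult (mult_of R) = mult R"
    by (rule field_mult_group) (simp_all add: nat_pow_mult_of)
  have "card {x \<in> carrier (mult_of R). G.ord x = 2 * n} > 0"
    using n by (subst card_elements_of_order[OF field_axioms fin dvd]) simp
  then obtain c where c: "c \<in> carrier R - {\<zero>}" "G.ord c = 2 * n"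
    by (force simp: card_gt_0_iff)
  have "(c [^] n) [^] (2::nat) = \<one>"
    using c G.pow_ord_eq_1[of c] by (simp add: nat_pow_pow mult.commute)
  moreover have "c [^] n \<noteq> \<one>"
    using c G.pow_eq_id[of c n] n by (auto dest: dvd_imp_le)
  ultimately have "c [^] n = \<ominus> \<one>"
    using square_eq_one[of "c [^] n"] c by auto
  then show thesis using that c \<open>c [^] n \<noteq> \<one>\<close> by simp
qed

section \<open>Elements of trace zero in the quartic extension\<close>

locale mersenne_quartic_field = field R for R (structure) +
  fixes p l :: nat
  assumes prime_p: "prime p" and p_l: "p + 1 = 2 ^ l" and order: "order R = p ^ 4"
begin

abbreviation "Q \<equiv> (p + 1) * (p\<^sup>2 + 1)"

text \<open>
  The image of the solutions under \<open>x \<mapsto> x ^ (p\<^sup>2 - 1)\<close>.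
\<close>
abbreviation "targets \<equiv> {u \<in> carrier R - {\<zero>}. group.ord (mult_of R) u = p\<^sup>2 + 1}"

abbreviation "solutions \<equiv> {x \<in> carrier R - {\<zero>}.
  group.ord (mult_of R) x = 2 * Q \<and> ff_trace R p 4 x = \<zero>}"

interpretation G: group "mult_of R"
  rewrites "([^]\<^bsub>mult_of R\<^esub>) = (([^]) :: _ \<Rightarrow> nat \<Rightarrow> _)"
    and "\<one>\<^bsub>mult_of R\<^esub> = \<one>"
    and "carrier (mult_of R) = carrier R - {\<zero>}"
    and "mult (mult_of R) = mult R"
  by (rule field_mult_group) (simp_all add: nat_pow_mult_of)

lemma p_mod_4: "p mod 4 = 3"
proof -
  have "l \<noteq> 0" "l \<noteq> 1"
    using p_l prime_ge_2_nat[OF prime_p] by (cases "l = 0"; cases "l = 1"; simp)+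
  then obtain m where "l = m + 2" by (metis One_nat_def Suc_1 add_2_eq_Suc' not0_implies_Suc)
  then have "p + 1 = 4 * 2 ^ m" using p_l by simp
  then have "p = 4 * (2 ^ m - 1) + 3"
    by (simp add: diff_mult_distrib2)
  then obtain k where "p = 4 * k + 3" ..
  then show ?thesis by simp
qed

lemma p_ge_3: "p \<ge> 3" and odd_p: "odd p"
  using p_mod_4 by presburger+

lemma finite_carrier: "finite (carrier R)"
  using order p_ge_3 by (simp add: order_def card_ge_0_finite)

lemma order_minus_one: "order R - 1 = 2 * Q * ((p - 1) div 2)"
proof -
  obtain k where k: "p = 2 * k + 1" using odd_p by (auto elim: oddE)
  show ?thesis unfolding order k
    by (simp add: power2_eq_square power4_eq_xxxx algebra_simps)
qed

lemma pow_order_minus_one: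
  assumes "x \<in> carrier R - {\<zero>}"
  shows "x [^] (order R - 1) = \<one>"
  using G.pow_order_eq_1[of x] assms finite_carrier
  by (simp add: order_mult_of)

lemma frobenius:
  fixes i :: nat
  assumes "a \<in> carrier R" "b \<in> carrier R"
  shows "(a \<oplus> b) [^] (p ^ i) = a [^] (p ^ i) \<oplus> b [^] (p ^ i)"
  using finite_domain_char[OF order] prime_p p_ge_3 assms
  by (intro frobenius_iterate_add) auto

text \<open>
  The trace is taken in two steps, through the subfield of order \<open>p\<^sup>2\<close>. The relative trace
  \<open>t = x \<oplus> x ^ (p\<^sup>2)\<close> is \<open>x\<close> times \<open>\<one> \<oplus> x ^ (p\<^sup>2 - 1)\<close>, and the trace is
  \<open>t \<oplus> t ^ p = t \<otimes> (\<one> \<oplus> t ^ (p - 1))\<close>.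
\<close>
lemma trace_zero_iff:
  assumes x: "x \<in> carrier R - {\<zero>}" and nz: "\<one> \<oplus> x [^] (p\<^sup>2 - 1) \<noteq> \<zero>"
  shows "ff_trace R p 4 x = \<zero> \<longleftrightarrow> (x \<otimes> (\<one> \<oplus> x [^] (p\<^sup>2 - 1))) [^] (p - 1) = \<ominus> \<one>"
proof -
  define t where "t = x \<otimes> (\<one> \<oplus> x [^] (p\<^sup>2 - 1))"
  have t: "t \<in> carrier R" "t \<noteq> \<zero>"
    using x nz integral by (auto simp: t_def)
  have "Suc (p\<^sup>2 - 1) = p\<^sup>2" using p_ge_3 by simp
  then have "x [^] (p\<^sup>2) = x [^] (p\<^sup>2 - 1) \<otimes> x" by (metis nat_pow_Suc)
  then have t_eq: "t = x \<oplus> x [^] (p\<^sup>2)"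
    using x by (simp add: t_def r_distr m_comm)
  have tp: "t [^] p = x [^] p \<oplus> x [^] (p ^ 3)"
    using frobenius[of x "x [^] (p\<^sup>2)" 1] x
    by (simp add: t_eq nat_pow_pow power_numeral_reduce mult.commute)
  have "{..<4::nat} = {..Suc (Suc (Suc 0))}" by auto
  then have "ff_trace R p 4 x = x [^] (p ^ 3) \<oplus> (x [^] (p\<^sup>2) \<oplus> (x [^] p \<oplus> x))"
    using x unfolding ff_trace_def by (simp add: finsum_Suc finsum_0 Pi_def numeral_eq_Suc)
  also have "\<dots> = t \<oplus> t [^] p" unfolding tp unfolding t_eq using x by (simp add: a_ac)
  also have "\<dots> = t \<otimes> (\<one> \<oplus> t [^] (p - 1))"
  proof -
    have "Suc (p - 1) = p" using p_ge_3 by simp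
    then have "t [^] p = t [^] (p - 1) \<otimes> t" by (metis nat_pow_Suc)
    then show ?thesis using t by (simp add: r_distr m_comm)
  qed
  finally have tr: "ff_trace R p 4 x = t \<otimes> (\<one> \<oplus> t [^] (p - 1))" .
  have "ff_trace R p 4 x = \<zero> \<longleftrightarrow> \<one> \<oplus> t [^] (p - 1) = \<zero>"
    unfolding tr using t integral_iff by auto
  also have "\<dots> \<longleftrightarrow> t [^] (p - 1) = \<ominus> \<one>"
    using t by (metis minus_equality nat_pow_closed one_closed r_neg a_comm)
  finally show ?thesis unfolding t_def .
qed

text \<open>
  Otherwise \<open>u = \<ominus> \<one>\<close> would have order at most \<open>2 < p\<^sup>2 + 1\<close>.
\<close>
lemma one_plus_nonzero:
  assumes "u \<in> targets"
  shows "\<one> \<oplus> u \<noteq> \<zero>"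
proof
  assume "\<one> \<oplus> u = \<zero>"
  then have "u = \<ominus> \<one>"
    using assms minus_equality[of u \<one>] by (simp add: a_comm)
  then have "u [^] (2::nat) = \<one>" using minus_power_even[of \<one> 2] by simp
  then have "p\<^sup>2 + 1 dvd 2" using G.pow_eq_id[of u 2] assms by auto
  then have "p\<^sup>2 + 1 \<le> 2" by (rule dvd_imp_le) simp
  then show False using p_ge_3 power_mono[of 3 p 2] by simp
qed

text \<open>
  Since \<open>u ^ (p\<^sup>2) = inv u\<close>, the Frobenius map gives \<open>(\<one> \<oplus> u) ^ (p\<^sup>2) = \<one> \<oplus> inv u\<close>, which is
  \<open>\<one> \<oplus> u\<close> divided by \<open>u\<close>. This explicit solution, as in Hilbert 90, of \<open>w ^ (p\<^sup>2 - 1) = inv u\<close> is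
  what makes the inverse images of \<open>u\<close> computable.
\<close>
lemma one_plus_power:
  assumes "u \<in> targets"
  shows "(\<one> \<oplus> u) [^] (p\<^sup>2 - 1) \<otimes> u = \<one>"
proof -
  let ?w = "\<one> \<oplus> u"
  have u: "u \<in> carrier R" "u \<in> carrier R - {\<zero>}" and ord: "G.ord u = p\<^sup>2 + 1"
    using assms by auto
  have "Suc (p\<^sup>2 - 1) = p\<^sup>2" using p_ge_3 by simp
  then have "?w [^] (p\<^sup>2) = ?w [^] (p\<^sup>2 - 1) \<otimes> ?w" by (metis nat_pow_Suc)
  then have "?w \<otimes> (?w [^] (p\<^sup>2 - 1) \<otimes> u) = ?w [^] (p\<^sup>2) \<otimes> u"
    using u by (simp add: m_ac)
  also have "\<dots> = u \<oplus> u [^] (p\<^sup>2 + 1)"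
    using u by (simp add: frobenius l_distr)
  also have "u [^] (p\<^sup>2 + 1) = \<one>"
    using G.pow_ord_eq_1[OF u(2)] unfolding ord .
  finally have "?w \<otimes> (?w [^] (p\<^sup>2 - 1) \<otimes> u) = ?w \<otimes> \<one>"
    using u by (simp add: a_comm)
  then show ?thesis
    using m_lcancel[of ?w "?w [^] (p\<^sup>2 - 1) \<otimes> u" \<one>] one_plus_nonzero[OF assms] u by simp
qed

lemma solution_power_in_targets:
  assumes "x \<in> carrier R - {\<zero>}" "group.ord (mult_of R) x = 2 * Q"
  shows "x [^] (p\<^sup>2 - 1) \<in> targets"
proof -
  have "G.ord (x [^] (p\<^sup>2 - 1)) = 2 * Q div (2 * (p + 1))"
    using G.ord_pow_gen[of x "p\<^sup>2 - 1"] gcd_exponents(2)[OF p_mod_4] assms p_ge_3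
    by auto
  also have "\<dots> = p\<^sup>2 + 1"
    by (subst mult.assoc[symmetric], rule nonzero_mult_div_cancel_left) simp
  finally show ?thesis using assms G.nat_pow_closed by auto
qed

lemma ord_eq_2Q:
  assumes "x \<in> carrier R - {\<zero>}" "x [^] (2 * Q) = \<one>" "x [^] (p\<^sup>2 - 1) \<in> targets"
  shows "group.ord (mult_of R) x = 2 * Q"
proof (rule order_eq_from_quotient[OF p_l])
  show "G.ord x dvd 2 * Q"
    using G.pow_eq_id[of x "2 * Q"] assms(1,2) by blast
  have "p\<^sup>2 - 1 \<noteq> 0" using p_ge_3 power_mono[of 3 p 2] by simp
  then show "G.ord x div gcd (G.ord x) (p\<^sup>2 - 1) = p\<^sup>2 + 1"
    using G.ord_pow_gen[of x "p\<^sup>2 - 1"] assms by auto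
qed (use p_ge_3 in simp)

text \<open>
  The quotient is killed by the exponents \<open>p - 1\<close> and \<open>2 * Q\<close>, hence by their gcd, which is \<open>2\<close>.
\<close>
lemma quotient_cases:
  assumes x: "x \<in> carrier R - {\<zero>}" and y: "y \<in> carrier R - {\<zero>}"
    and "x [^] (p - 1) = y [^] (p - 1)" and "x [^] (2 * Q) = y [^] (2 * Q)"
  shows "y = x \<or> y = \<ominus> x"
proof -
  define f where "f = y \<otimes> inv x"
  have x': "x \<in> Units R" using x field_Units by simp
  have f: "f \<in> carrier R" and y_eq: "y = f \<otimes> x"
    using x' x y by (simp_all add: f_def m_assoc)
  then have f': "f \<in> carrier R - {\<zero>}" using y x by auto
  have *: "f [^] n = \<one>" if "x [^] n = y [^] n" for n :: nat
  proof -
    have "f [^] n \<otimes> x [^] n = \<one> \<otimes> x [^] n"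
      using that f x by (simp add: y_eq nat_pow_distrib)
    moreover have "x [^] n \<in> carrier R - {\<zero>}" using G.nat_pow_closed[OF x] .
    ultimately show ?thesis using f m_rcancel[of "x [^] n" "f [^] n" \<one>] by simp
  qed
  have "G.ord f dvd gcd (2 * Q) (p - 1)"
    by (intro gcd_greatest G.pow_eq_id[OF f', THEN iffD1] * assms)
  then have "f [^] (2::nat) = \<one>"
    unfolding gcd_exponents(1)[OF p_mod_4] by (rule G.pow_eq_id[OF f', THEN iffD2])
  then have "f = \<one> \<or> f = \<ominus> \<one>" by (rule square_eq_one[OF f])
  then show ?thesis using x y_eq by (auto simp: l_minus)
qed

text \<open>
  Once \<open>x ^ (p\<^sup>2 - 1)\<close> is known to lie in \<open>targets\<close>, being a solution amounts to two power
  equations; these behave well under the quotients and the change of sign used for the fibres.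
\<close>
lemma in_solutions_iff:
  assumes x: "x \<in> carrier R - {\<zero>}" and u: "x [^] (p\<^sup>2 - 1) \<in> targets"
  shows "x \<in> solutions \<longleftrightarrow> x [^] (2 * Q) = \<one> \<and> (x \<otimes> (\<one> \<oplus> x [^] (p\<^sup>2 - 1))) [^] (p - 1) = \<ominus> \<one>"
proof -
  have "group.ord (mult_of R) x = 2 * Q \<longleftrightarrow> x [^] (2 * Q) = \<one>"
    using ord_eq_2Q[OF x _ u] G.pow_ord_eq_1[OF x] by metis
  then show ?thesis
    using x trace_zero_iff[OF x one_plus_nonzero[OF u]] by blast
qed

text \<open>
  With \<open>u\<close> fixed, the trace condition determines \<open>x ^ (p - 1)\<close>, and together with
  \<open>x ^ (2 * Q) = \<one>\<close> this determines \<open>x\<close> up to sign. Conversely, all the exponents involved are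
  even, so the sign is free.
\<close>
lemma fibre_two_elements:
  assumes x: "x \<in> solutions" and u: "u = x [^] (p\<^sup>2 - 1)"
  shows "{y \<in> solutions. y [^] (p\<^sup>2 - 1) = u} = {x, \<ominus> x}"
proof -
  have x0: "x \<in> carrier R - {\<zero>}" and xU: "x [^] (p\<^sup>2 - 1) \<in> targets"
    using x solution_power_in_targets by blast+
  have w: "\<one> \<oplus> u \<in> carrier R" "\<one> \<oplus> u \<noteq> \<zero>"
    using one_plus_nonzero[OF xU] x0 by (simp_all add: u)
  have w': "(\<one> \<oplus> u) [^] (p - 1) \<in> carrier R - {\<zero>}"
    using G.nat_pow_closed[of "\<one> \<oplus> u"] w by simp
  have xS: "x [^] (2 * Q) = \<one>" "(x \<otimes> (\<one> \<oplus> u)) [^] (p - 1) = \<ominus> \<one>"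
    using x in_solutions_iff[OF x0 xU] u by blast+
  define A where "A = {y \<in> solutions. y [^] (p\<^sup>2 - 1) = u}"
  have "x \<in> A" using x u by (simp add: A_def)
  moreover have "\<ominus> x \<in> A"
  proof -
    have m0: "\<ominus> x \<in> carrier R - {\<zero>}" using x0 by auto
    have mu: "(\<ominus> x) [^] (p\<^sup>2 - 1) = u"
      using x0 u odd_p by (subst minus_power_even) auto
    have "(\<ominus> x) [^] (2 * Q) = \<one>"
      using x0 xS(1) minus_power_even[of x "2 * Q"] by simp
    moreover have "(\<ominus> x \<otimes> (\<one> \<oplus> u)) [^] (p - 1) = \<ominus> \<one>"
      using x0 w xS(2) minus_power_even[of "x \<otimes> (\<one> \<oplus> u)" "p - 1"] odd_p
      by (simp add: l_minus)
    ultimately show ?thesis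
      using in_solutions_iff[OF m0] mu xU u by (simp add: A_def)
  qed
  moreover have "y = x \<or> y = \<ominus> x" if "y \<in> A" for y
  proof -
    have yS: "y \<in> solutions" and yu: "y [^] (p\<^sup>2 - 1) = u"
      using that by (simp_all add: A_def)
    have y0: "y \<in> carrier R - {\<zero>}" using yS by blast
    have "y [^] (2 * Q) = \<one>" "(y \<otimes> (\<one> \<oplus> u)) [^] (p - 1) = \<ominus> \<one>"
      using yS in_solutions_iff[OF y0] xU u yu by simp_all
    then have "x [^] (2 * Q) = y [^] (2 * Q)"
      and "x [^] (p - 1) \<otimes> (\<one> \<oplus> u) [^] (p - 1) = y [^] (p - 1) \<otimes> (\<one> \<oplus> u) [^] (p - 1)"
      using xS x0 y0 w(1) by (simp_all add: nat_pow_distrib)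
    then show ?thesis
      using x0 y0 w' m_rcancel by (intro quotient_cases) auto
  qed
  ultimately have "A = {x, \<ominus> x}" by blast
  then show ?thesis by (simp only: A_def)
qed

text \<open>
  Take \<open>c\<close> with \<open>c ^ (p - 1) = \<ominus> \<one>\<close> and \<open>z = c / (\<one> \<oplus> u)\<close>. Then \<open>z ^ (p\<^sup>2 - 1) = u\<close> because
  \<open>c ^ (p\<^sup>2 - 1) = \<one>\<close>, and \<open>z\<close> has trace zero, but its order need not divide \<open>2 * Q\<close>. As
  \<open>2 * Q\<close> is coprime to the complementary factor \<open>k = (p - 1) / 2\<close> of the group order, some power
  of \<open>z\<close> is its component of order dividing \<open>2 * Q\<close>. It differs from \<open>z\<close> only by a \<open>k\<close>-th root
  of unity, that is, by an element of the prime field, which affects neither the trace condition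
  nor \<open>u\<close>.
\<close>
lemma fibre_nonempty:
  assumes u: "u \<in> targets"
  shows "\<exists>x\<in>solutions. x [^] (p\<^sup>2 - 1) = u"
proof -
  define k where "k = (p - 1) div 2"
  define w where "w = \<one> \<oplus> u"
  have p_k: "p - 1 = 2 * k" using odd_p by (auto simp: k_def elim: oddE)
  have order_k: "order R - 1 = 2 * Q * k" by (simp only: order_minus_one k_def)
  have u0: "u \<in> carrier R - {\<zero>}" and ord_u: "G.ord u = p\<^sup>2 + 1"
    using u by simp_all
  have w: "w \<in> carrier R" "w \<in> Units R"
    using u0 one_plus_nonzero[OF u] field_Units by (simp_all add: w_def)
  obtain c where c: "c \<in> carrier R - {\<zero>}" "c [^] (p - 1) = \<ominus> \<one>"
  proof (rule root_of_minus_one[OF finite_carrier, of "p - 1"])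
    have "even Q" using odd_p by simp
    then obtain m where "Q = 2 * m" by blast
    then show "2 * (p - 1) dvd order R - 1"
      unfolding order_k p_k by simp
  qed (use p_ge_3 that in auto)
  define z where "z = c \<otimes> inv w"
  have z: "z \<in> carrier R" and zw: "z \<otimes> w = c"
    using c w by (simp_all add: z_def m_assoc)
  then have z0: "z \<in> carrier R - {\<zero>}" using c w by auto
  have N: "p\<^sup>2 - 1 = (p - 1) * (p + 1)"
    by (simp add: power2_eq_square algebra_simps)
  have "c [^] (p\<^sup>2 - 1) = (\<ominus> \<one>) [^] (p + 1)"
    unfolding N c(2)[symmetric] using c(1) by (simp only: nat_pow_pow Diff_iff)
  also have "\<dots> = \<one>"
    using minus_power_even[of \<one> "p + 1"] odd_p by (simp del: nat_pow_Suc)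
  finally have "c [^] (p\<^sup>2 - 1) = \<one>" .
  then have "z [^] (p\<^sup>2 - 1) \<otimes> w [^] (p\<^sup>2 - 1) = \<one>"
    using z w by (simp add: zw nat_pow_distrib[symmetric])
  then have "z [^] (p\<^sup>2 - 1) \<otimes> w [^] (p\<^sup>2 - 1) \<otimes> u = u"
    using u0 by simp
  then have zu: "z [^] (p\<^sup>2 - 1) = u"
    using one_plus_power[OF u] z w u0 by (simp add: w_def[symmetric] m_assoc)
  have "2 * gcd Q k = 2"
    using gcd_exponents(1)[OF p_mod_4] unfolding p_k gcd_mult_distrib_nat .
  then have "gcd Q k = 1" by linarith
  then have "coprime k Q"
    by (metis coprime_iff_gcd_eq_1 coprime_commute)
  moreover have "odd k"
    using p_mod_4 p_k by presburger
  then have "coprime k 2" by simp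
  ultimately have "coprime k (2 * Q)"
    unfolding coprime_mult_right_iff by blast
  then obtain y where "[k * y = Suc 0] (mod 2 * Q)"
    using cong_solve_coprime_nat by blast
  then obtain j where kj: "k * y = 1 + 2 * Q * j"
  proof -
    assume *: "\<And>j. k * y = 1 + 2 * Q * j \<Longrightarrow> thesis"
    have "k * y mod (2 * Q) = 1"
      using \<open>[k * y = Suc 0] (mod 2 * Q)\<close> by (simp add: cong_def)
    then show thesis
      using *[of "k * y div (2 * Q)"] by (metis add.commute mult_div_mod_eq)
  qed
  \<comment> \<open>The exponent is \<open>1\<close> modulo \<open>2 * Q\<close> and \<open>0\<close> modulo \<open>k\<close>: it projects to order dividing \<open>2 * Q\<close>.\<close>
  define x where "x = z [^] (k * y)"
  have x0: "x \<in> carrier R - {\<zero>}" using G.nat_pow_closed[OF z0] by (simp add: x_def)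
  have "x [^] (2 * Q) = (z [^] (order R - 1)) [^] y"
    unfolding x_def order_k using z
    by (simp only: nat_pow_pow mult_ac)
  then have xQ: "x [^] (2 * Q) = \<one>"
    using pow_order_minus_one[OF z0] by simp
  have "p\<^sup>2 + 1 dvd 2 * Q * j"
    by (intro dvd_mult2 dvd_mult dvd_refl)
  then have "u [^] (2 * Q * j) = \<one>"
    by (simp only: G.pow_eq_id[OF u0] ord_u)
  then have "u [^] (k * y) = u"
    using u0 by (simp add: kj nat_pow_mult[symmetric])
  moreover have "x [^] (p\<^sup>2 - 1) = (z [^] (p\<^sup>2 - 1)) [^] (k * y)"
    unfolding x_def using z by (simp only: nat_pow_pow mult_ac)
  ultimately have xu: "x [^] (p\<^sup>2 - 1) = u"
    by (simp only: zu)
  have "x \<otimes> w = c \<otimes> z [^] (2 * Q * j)"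
    using z w by (simp add: x_def kj nat_pow_mult[symmetric] zw[symmetric] m_ac)
  then have "(x \<otimes> w) [^] (p - 1) = c [^] (p - 1) \<otimes> z [^] (2 * Q * j * (p - 1))"
    using z c by (simp add: nat_pow_distrib nat_pow_pow)
  also have "2 * Q * j * (p - 1) = (order R - 1) * (2 * j)"
    unfolding order_k p_k by (simp only: mult_ac)
  also have "z [^] \<dots> = \<one>"
    using pow_order_minus_one[OF z0] z by (simp add: nat_pow_pow[symmetric])
  finally have "(x \<otimes> w) [^] (p - 1) = \<ominus> \<one>" using c by simp
  then show ?thesis
    using in_solutions_iff[OF x0] xu u xQ by (intro bexI[of _ x]) (simp_all add: w_def)
qed

lemma card_solutions: "card solutions = 2 * totient (p\<^sup>2 + 1)"
proof -
  have dvd: "p\<^sup>2 + 1 dvd order R - 1"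
    unfolding order_minus_one by (intro dvd_mult2 dvd_mult dvd_refl)
  have card_targets: "card targets = totient (p\<^sup>2 + 1)"
    using card_elements_of_order[OF field_axioms finite_carrier dvd] by simp
  have fin: "finite targets" using finite_carrier by auto
  have "card solutions = (\<Sum>u\<in>targets. card {x \<in> solutions. x [^] (p\<^sup>2 - 1) = u})"
  proof -
    have "solutions = (\<Union>u\<in>targets. {x \<in> solutions. x [^] (p\<^sup>2 - 1) = u})"
      using solution_power_in_targets by blast
    then have "card solutions = card (\<Union>u\<in>targets. {x \<in> solutions. x [^] (p\<^sup>2 - 1) = u})"
      by (rule arg_cong)
    also have "\<dots> = (\<Sum>u\<in>targets. card {x \<in> solutions. x [^] (p\<^sup>2 - 1) = u})"
      by (rule card_UN_disjoint) (use fin finite_carrier in auto)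
    finally show ?thesis .
  qed
  also have "\<dots> = (\<Sum>u\<in>targets. 2)"
  proof (rule sum.cong[OF refl])
    fix u assume "u \<in> targets"
    then obtain x where x: "x \<in> solutions" "u = x [^] (p\<^sup>2 - 1)"
      using fibre_nonempty by blast
    have "2 * 1 dvd order R - 1"
      unfolding order_minus_one by (simp add: mult.assoc)
    then obtain "\<ominus> \<one> \<noteq> \<one>"
      using root_of_minus_one[OF finite_carrier, of 1] by auto
    then have "x \<noteq> \<ominus> x"
      using x(1) m_rcancel[of x "\<ominus> \<one>" \<one>] by (auto simp: l_minus)
    then show "card {x \<in> solutions. x [^] (p\<^sup>2 - 1) = u} = 2"
      unfolding fibre_two_elements[OF x] by simp
  qed
  finally show ?thesis by (simp only: sum_constant card_targets of_nat_id mult.commute)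
qed

end

section \<open>The totient of \<open>2 * Q\<close>\<close>

lemma totient_power_2_mult:
  assumes "even n"
  shows "totient (2 ^ k * n) = 2 ^ k * totient n"
proof (induction k)
  case (Suc k)
  have "totient (2 ^ Suc k * n) = totient (2 * (2 ^ k * n))" by (simp add: mult.assoc)
  with Suc assms show ?case by (simp add: totient_double)
qed simp

theorem theorem6p5:
  fixes F :: "('a, 'b) ring_scheme" and p Q :: nat
  assumes "mersenne_prime p"
    and "field F"
    and "order F = p ^ 4"
    and "Q = (p ^ 4 - 1) div (p - 1)"
  shows "Q = (p + 1) * (p ^ 2 + 1)
    \<and> real (card {\<xi> \<in> carrier (mult_of F).
          group.ord (mult_of F) \<xi> = 2 * Q \<and> ff_trace F p 4 \<xi> = \<zero>\<^bsub>F\<^esub>})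
        = real (totient (2 * Q)) / real (p + 1)
    \<and> real (totient (2 * Q)) / real (p + 1) = 2 * real (totient (p ^ 2 + 1))"
proof -
  obtain l where p: "prime p" and "p = 2 ^ l - 1"
    using assms(1) by (auto simp: mersenne_prime_def)
  then have p_l: "p + 1 = 2 ^ l" by simp
  interpret mersenne_quartic_field F p l
    using assms p p_l by (auto simp: mersenne_quartic_field_def mersenne_quartic_field_axioms_def)
  have "p ^ 4 - 1 = (p - 1) * ((p + 1) * (p\<^sup>2 + 1))"
    using order_minus_one order p_ge_3 odd_p by (auto elim!: oddE)
  then have Q: "Q = (p + 1) * (p\<^sup>2 + 1)"
    unfolding assms(4) using p_ge_3 by (simp only: nonzero_mult_div_cancel_left)
  have "totient (2 * Q) = totient (2 ^ Suc l * (p\<^sup>2 + 1))"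
    unfolding Q p_l by (simp only: power_Suc mult.assoc)
  also have "\<dots> = 2 ^ Suc l * totient (p\<^sup>2 + 1)"
    using odd_p by (intro totient_power_2_mult) simp
  also have "\<dots> = (p + 1) * (2 * totient (p\<^sup>2 + 1))"
    by (simp only: p_l power_Suc mult_ac)
  finally have "real (totient (2 * Q)) / real (p + 1) = 2 * real (totient (p\<^sup>2 + 1))"
    by (simp only: of_nat_mult of_nat_numeral) (simp del: of_nat_add)
  moreover have "card {\<xi> \<in> carrier (mult_of F).
      group.ord (mult_of F) \<xi> = 2 * Q \<and> ff_trace F p 4 \<xi> = \<zero>\<^bsub>F\<^esub>} = 2 * totient (p\<^sup>2 + 1)"
    using card_solutions by (simp only: Q carrier_mult_of)
  ultimately show ?thesis using Q by simp
qed

end
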